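(* Let $n\ge4$ be even and let $B_1$ be the open unit ball in $\mathbb R^n$. For every $C_0>0$ and $\alpha\in(0,1]$ there exists a constant $C_1=C_1(n,C_0,\alpha)$ such that the following holds. Suppose that $u$ is a positive continuous function on $\bar B_1\setminus\{0\}$ satisfying $$\lambda(A^u)\in\mathbb R^n\setminus\{\lambda\in\Gamma_{n/2}:\sigma_{n/2}(\lambda)>1\}\quad\text{in }B_1\setminus\{0\}\text{ in the viscosity sense},$$ $$\limsup_{|x|\to0}u(x)<\infty .$$ If $u(x)\le C_0|x|^{-\frac{n-2}2(1-\alpha)}$ in $\bar B_1\setminus\{0\}$, then $$u(x)\le C_1\quad\text{in }\bar B_1\setminus\{0\}.$$
   Context: For a positive $C^2$ function $u$ on an open subset of $\mathbb R^n$, $A^u$ is the $(1,1)$-Schouten tensor of $u^{\frac4{n-2}}\mathring g$ ($\mathring g$ Euclidean), i.e. $$A^u=-\tfrac2{n-2}u^{-\frac{n+2}{n-2}}\nabla^2u+\tfrac{2n}{(n-2)^2}u^{-\frac{2n}{n-2}}\,du\otimes du-\tfrac2{(n-2)^2}u^{-\frac{2n}{n-2}}|du|^2 I,$$ with eigenvalues $\lambda(A^u)$. $\sigma_k$ is the $k$-th elementary symmetric function and $\Gamma_k$ is the connected component of $\{\lambda\in\mathbb R^n:\sigma_k(\lambda)>0\}$ containing the positive cone. Viscosity sense: with $U=\{\lambda\in\Gamma_{n/2}:\sigma_{n/2}(\lambda)>1\}$, a positive continuous $u$ satisfies $\lambda(A^u)\in\mathbb R^n\setminus U$ in an open set $D$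 in the viscosity sense if, whenever $x_0\in D$, $\varphi$ is $C^2$ near $x_0$, $\varphi(x_0)=u(x_0)$ and $\varphi\ge u$ near $x_0$, one has $\lambda(A^\varphi(x_0))\in\mathbb R^n\setminus U$. *)

theory Defs
  imports "HOL-Analysis.Analysis"
begin

section \<open>Partial derivatives and C2 functions\<close>

definition partial_deriv :: "'n \<Rightarrow> (real^'n \<Rightarrow> real) \<Rightarrow> real^'n \<Rightarrow> real" where
  "partial_deriv i f x = frechet_derivative f (at x) (axis i 1)"

definition grad :: "(real^'n \<Rightarrow> real) \<Rightarrow> real^'n \<Rightarrow> real^'n" where
  "grad f x = (\<chi> i. partial_deriv i f x)"

definition hessian :: "(real^'n \<Rightarrow> real) \<Rightarrow> real^'n \<Rightarrow> real^'n^'n" where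
  "hessian f x = (\<chi> i j. partial_deriv i (partial_deriv j f) x)"

definition C2_on :: "(real^'n) set \<Rightarrow> (real^'n \<Rightarrow> real) \<Rightarrow> bool" where
  "C2_on S f \<longleftrightarrow> open S \<and> f differentiable_on S \<and>
     (\<forall>i. partial_deriv i f differentiable_on S) \<and>
     (\<forall>i j. continuous_on S (partial_deriv i (partial_deriv j f)))"

section \<open>Schouten tensor and eigenvalues\<close>

definition outer :: "real^'n \<Rightarrow> real^'n \<Rightarrow> real^'n^'n" where
  "outer v w = (\<chi> i j. v $ i * w $ j)"

definition schouten :: "(real^'n \<Rightarrow> real) \<Rightarrow> real^'n \<Rightarrow> real^'n^'n" where
  "schouten u x = (let n = real CARD('n) in
     (- 2 / (n - 2) * u x powr (- (n + 2) / (n - 2))) *\<^sub>R hessian u x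
     + (2 * n / (n - 2)^2 * u x powr (- 2 * n / (n - 2))) *\<^sub>R outer (grad u x) (grad u x)
     - (2 / (n - 2)^2 * u x powr (- 2 * n / (n - 2)) * (norm (grad u x))^2) *\<^sub>R mat 1)"

text \<open>The eigenvalues of a real symmetric matrix, counted with multiplicity, form a vector that
  is determined only up to permutation of its entries. The following set consists of all these
  orderings; a statement ``the eigenvalues of A lie in S'', for a permutation-invariant set S,
  is rendered as ``eigenvalue_vectors A is contained in S''.\<close>

definition eigenvalue_vectors :: "real^'n^'n \<Rightarrow> (real^'n) set" where
  "eigenvalue_vectors A = {l. \<forall>t. det (mat t - A) = (\<Prod>i\<in>UNIV. t - l $ i)}"

lemma diagonal_eigenvalue_vectors:
  "l \<in> eigenvalue_vectors (\<chi> i j. if i = j then l $ i else 0)"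
  unfolding eigenvalue_vectors_def
  by (auto simp: mat_def det_diagonal)

section \<open>Elementary symmetric functions and the cones\<close>

definition elem_sym :: "nat \<Rightarrow> real^'n \<Rightarrow> real" where
  "elem_sym k l = (\<Sum>S | S \<subseteq> (UNIV :: 'n set) \<and> card S = k. \<Prod>i\<in>S. l $ i)"

definition positive_cone :: "(real^'n) set" where
  "positive_cone = {l. \<forall>i. 0 < l $ i}"

text \<open>The positive cone is connected and contains the vector (1,...,1), so the component of that
  vector is the component containing the positive cone; see the lemmas below.\<close>

definition Gamma_cone :: "nat \<Rightarrow> (real^'n) set" where
  "Gamma_cone k = connected_component_set {l. 0 < elem_sym k l} (\<chi> i. 1)"

lemma positive_cone_elem_sym_pos:
  fixes l :: "real^'n"
  assumes "l \<in> positive_cone" and "k \<le> CARD('n)"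
  shows "0 < elem_sym k l"
proof -
  obtain S :: "'n set" where "S \<subseteq> UNIV" "card S = k"
    using assms(2) by (metis obtain_subset_with_card_n)
  then have "{S. S \<subseteq> (UNIV :: 'n set) \<and> card S = k} \<noteq> {}" by blast
  then show ?thesis
    unfolding elem_sym_def using assms(1)
    by (intro sum_pos) (auto simp: positive_cone_def intro!: prod_pos)
qed

lemma positive_cone_subset_Gamma_cone:
  assumes "k \<le> CARD('n)"
  shows "(positive_cone :: (real^'n) set) \<subseteq> Gamma_cone k"
  unfolding Gamma_cone_def
proof (rule connected_component_maximal)
  have "positive_cone = (\<Inter>i. {l :: real^'n. 0 < axis i 1 \<bullet> l})"
    by (auto simp: positive_cone_def inner_axis')
  moreover have "convex (\<Inter>i. {l :: real^'n. 0 < axis i 1 \<bullet> l})"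
    by (intro convex_INT convex_halfspace_gt)
  ultimately show "connected (positive_cone :: (real^'n) set)"
    using convex_connected by metis
  show "(\<chi> i. 1) \<in> (positive_cone :: (real^'n) set)"
    by (simp add: positive_cone_def)
  show "(positive_cone :: (real^'n) set) \<subseteq> {l. 0 < elem_sym k l}"
    using positive_cone_elem_sym_pos[OF _ assms] by auto
qed

lemma Gamma_cone_component:
  assumes "k \<le> CARD('n)"
  shows "(Gamma_cone k :: (real^'n) set) \<in> components {l. 0 < elem_sym k l}"
  unfolding Gamma_cone_def
  using positive_cone_elem_sym_pos[OF _ assms, of "(\<chi> i. 1) :: real^'n"]
  by (auto simp: components_def positive_cone_def)

definition U_set :: "(real^'n) set" where
  "U_set = {l \<in> Gamma_cone (CARD('n) div 2). 1 < elem_sym (CARD('n) div 2) l}"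

section \<open>Viscosity sense\<close>

definition visc_outside_U :: "(real^'n) set \<Rightarrow> (real^'n \<Rightarrow> real) \<Rightarrow> bool" where
  "visc_outside_U D u \<longleftrightarrow>
     (\<forall>x0\<in>D. \<forall>\<phi>. (\<exists>N. x0 \<in> N \<and> C2_on N \<phi>) \<longrightarrow> \<phi> x0 = u x0 \<longrightarrow>
        (\<forall>\<^sub>F x in nhds x0. u x \<le> \<phi> x) \<longrightarrow>
        eigenvalue_vectors (schouten \<phi> x0) \<subseteq> UNIV - U_set)"

end

theory Submission
  imports Defs
begin

text \<open>
  Let \<open>m = (n - 2) / 2\<close> and write a conformal factor as \<open>exp (- m * w)\<close>. For a radial \<open>w\<close>, the
  Schouten tensor has one radial eigenvalue \<open>A\<close> and \<open>n - 1\<close> equal tangential eigenvalues \<open>b\<close>. The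
  order \<open>k = n / 2\<close> is special because the two binomial coefficients in \<open>\<sigma>_k (A, b, ..., b)\<close>
  agree, so that \<open>\<sigma>_k\<close> is a positive multiple of \<open>b ^ (k - 1) * (A + b)\<close>
  (\<open>elem_sym_half_spike\<close>). In the logarithmic radius \<open>t\<close> and with \<open>w = \<xi> t + t\<close>, one has
  \<open>A + b = exp (2 * \<xi>) * \<xi>''\<close> and \<open>2 * b = exp (2 * \<xi>) * (1 - \<xi>'\<^sup>2)\<close>. Hence, where
  \<open>\<xi>'' > 0\<close> and \<open>|\<xi>'| < 1\<close>, the eigenvalues lie in \<open>U\<close> as soon as \<open>\<xi>\<close> is large enough, and then by the
  viscosity condition the conformal factor cannot touch \<open>u\<close> from above.

  With \<open>z = norm x / r\<close>, the barriers are \<open>w_a = c + (1 - a) * ln z + z powr \<alpha> / 2\<close> on the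
  ball of radius \<open>r\<close>, for \<open>\<alpha> / 2 \<le> a < 1\<close>. The assumed bound on \<open>u\<close> lets \<open>c\<close> be
  \<open>(1 - \<alpha>) * ln r\<close> up to an additive constant: then \<open>exp (- m * w_a)\<close> exceeds \<open>u\<close> on the whole
  ball for \<open>a = \<alpha> / 2\<close> and on the boundary sphere for every \<open>a\<close>. For \<open>w_a\<close>,
  both \<open>b\<close> and \<open>A + b\<close> are bounded below by multiples of \<open>exp (2 * c) / r\<^sup>2\<close>, hence of
  \<open>r powr (- 2 * \<alpha>)\<close>, uniformly in \<open>a\<close>, so for small \<open>r\<close> the eigenvalues lie in \<open>U\<close> (\<open>barrier_meets_U_set\<close>); this is where the gain \<open>\<alpha> > 0\<close> enters. Now let \<open>a\<close>
  increase from \<open>\<alpha> / 2\<close>. Each barrier with \<open>a < 1\<close> tends to infinity at the origin whereas \<open>u\<close> is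
  bounded there, so a first contact would be at an interior point away from the origin, which is
  impossible (\<open>subsolution_below_barrier\<close>). Letting \<open>a\<close> tend to 1 removes the singularity and
  leaves the bound \<open>u \<le> exp (- m * c)\<close>, in which \<open>c\<close> depends on \<open>n\<close>, \<open>C0\<close> and \<open>\<alpha>\<close> only.
\<close>

section \<open>Eigenvalue vectors with one exceptional entry\<close>

text \<open>
  For \<open>n = 2 * k\<close>, complementation is a bijection between the \<open>k\<close>-subsets that avoid the
  exceptional index and those that contain it. The former contribute \<open>b ^ k\<close> and the latter
  \<open>a * b ^ (k - 1)\<close>.
\<close>

lemma elem_sym_half_spike:
  fixes i0 :: "'n::finite"
  assumes "CARD('n) = 2 * k" "1 \<le> k"
  shows "elem_sym k (\<chi> i::'n. if i = i0 then a else b) =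
    real (card {S :: 'n set. i0 \<notin> S \<and> card S = k}) * (b ^ (k - 1) * (a + b))"
proof -
  let ?l = "\<chi> i::'n. if i = i0 then a else b"
  let ?A = "{S :: 'n set. i0 \<notin> S \<and> card S = k}"
  let ?B = "{S :: 'n set. i0 \<in> S \<and> card S = k}"
  have out: "(\<Prod>i\<in>S. ?l $ i) = b ^ k" if "S \<in> ?A" for S
  proof -
    have "(\<Prod>i\<in>S. ?l $ i) = (\<Prod>i\<in>S. b)"
      using that by (intro prod.cong) auto
    then show ?thesis using that by simp
  qed
  have ins: "(\<Prod>i\<in>S. ?l $ i) = a * b ^ (k - 1)" if "S \<in> ?B" for S
  proof -
    have "(\<Prod>i\<in>S. ?l $ i) = ?l $ i0 * (\<Prod>i\<in>S - {i0}. ?l $ i)"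
      using that by (intro prod.remove) auto
    also have "(\<Prod>i\<in>S - {i0}. ?l $ i) = (\<Prod>i\<in>S - {i0}. b)"
      by (intro prod.cong) auto
    finally show ?thesis using that by simp
  qed
  have "bij_betw uminus ?A ?B"
    by (rule bij_betw_byWitness[where f' = uminus])
      (use assms in \<open>auto simp: Compl_eq_Diff_UNIV card_Diff_subset\<close>)
  then have card_eq: "card ?B = card ?A"
    by (simp add: bij_betw_same_card)
  have "elem_sym k ?l = (\<Sum>S \<in> ?A \<union> ?B. \<Prod>i\<in>S. ?l $ i)"
    unfolding elem_sym_def by (intro sum.cong) auto
  also have "\<dots> = (\<Sum>S\<in>?A. \<Prod>i\<in>S. ?l $ i) + (\<Sum>S\<in>?B. \<Prod>i\<in>S. ?l $ i)"
    by (intro sum.union_disjoint) auto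
  also have "\<dots> = real (card ?A) * b ^ k + real (card ?B) * (a * b ^ (k - 1))"
    using out ins by simp
  also have "\<dots> = real (card ?A) * (b ^ (k - 1) * (a + b))"
    using assms(2) unfolding card_eq by (cases k) (auto simp: algebra_simps)
  finally show ?thesis .
qed

text \<open>
  Along the segment from the all-ones vector, entries keep the same pattern and both \<open>b\<close> and
  \<open>a + b\<close> remain positive, so the segment does not leave the set where the symmetric function is
  positive. The radial entry \<open>a\<close> itself may be negative, so the inclusion of the positive
  cone in the component would not be enough.
\<close>

lemma spike_in_U_set:
  fixes i0 :: "'n::finite"
  assumes "CARD('n) = 2 * k" "1 \<le> k" and "1 < b" "1 < a + b"
  shows "(\<chi> i::'n. if i = i0 then a else b) \<in> U_set"
proof -
  let ?l = "\<lambda>a b. \<chi> i::'n. if i = i0 then a else (b :: real)"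
  let ?N = "card {S :: 'n set. i0 \<notin> S \<and> card S = k}"
  have "k \<le> card (- {i0})"
    using assms(1,2) by (simp add: Compl_eq_Diff_UNIV card_Diff_subset)
  then obtain S where "S \<subseteq> - {i0}" "card S = k"
    by (metis obtain_subset_with_card_n)
  then have "{S :: 'n set. i0 \<notin> S \<and> card S = k} \<noteq> {}" by blast
  then have N: "1 \<le> real ?N"
    by (simp add: Suc_le_eq card_gt_0_iff)
  have pos: "0 < elem_sym k (?l a' b')" if "0 < b'" "0 < a' + b'" for a' b'
    unfolding elem_sym_half_spike[OF assms(1,2)] using that N by (intro mult_pos_pos) auto
  have seg: "closed_segment (\<chi> i. 1) (?l a b) \<subseteq> {l. 0 < elem_sym k l}"
  proof
    fix z assume "z \<in> closed_segment (\<chi> i. 1) (?l a b)"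
    then obtain u where u: "0 \<le> u" "u \<le> 1"
      and z: "z = (1 - u) *\<^sub>R (\<chi> i. 1) + u *\<^sub>R ?l a b"
      by (auto simp: in_segment)
    have "z = ?l ((1 - u) + u * a) ((1 - u) + u * b)"
      unfolding z by (simp add: vec_eq_iff)
    moreover have "1 \<le> (1 - u) + u * b"
      using mult_left_mono[of 1 b u] u assms(3) by simp
    moreover have "0 < ((1 - u) + u * a) + ((1 - u) + u * b)"
      using mult_left_mono[of 1 "a + b" u] u assms(4) by (simp add: algebra_simps)
    ultimately show "z \<in> {l. 0 < elem_sym k l}"
      using pos[of "(1 - u) + u * b" "(1 - u) + u * a"] by simp
  qed
  have "connected_component {l. 0 < elem_sym k l} (\<chi> i. 1) (?l a b)"
    unfolding connected_component_def
    using seg connected_segment(1)[of "\<chi> i. 1" "?l a b"] by (metis ends_in_segment)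
  then have "?l a b \<in> Gamma_cone k"
    unfolding Gamma_cone_def by simp
  moreover have "1 < elem_sym k (?l a b)"
  proof -
    have "1 \<le> b ^ (k - 1)" using assms(3) by simp
    then have "1 * 1 < b ^ (k - 1) * (a + b)"
      using assms(4) by (intro mult_le_less_imp_less) auto
    then have "1 * 1 < real ?N * (b ^ (k - 1) * (a + b))"
      using N by (intro mult_le_less_imp_less) auto
    then show ?thesis unfolding elem_sym_half_spike[OF assms(1,2)] by simp
  qed
  ultimately show ?thesis
    unfolding U_set_def using assms(1) by simp
qed

lemma conjugate_outer:
  fixes Q :: "real^'n^'n"
  shows "Q ** outer v w ** transpose Q = outer (Q *v v) (Q *v w)"
  by (simp add: vec_eq_iff outer_def matrix_matrix_mult_def matrix_vector_mult_def
      transpose_def sum_distrib_left sum_distrib_right mult_ac)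

text \<open>A rotation that takes \<open>x\<close> to a coordinate axis diagonalises the matrix.\<close>

lemma eigenvalue_vector_scalar_plus_outer:
  fixes x :: "real^'n" and i0 :: 'n
  shows "(\<chi> i. if i = i0 then p + q * (x \<bullet> x) else p)
    \<in> eigenvalue_vectors (p *\<^sub>R mat 1 + q *\<^sub>R outer x x)"
proof -
  have "norm (norm x *\<^sub>R axis i0 (1::real)) = norm x" by (simp add: norm_axis_1)
  then obtain f :: "real^'n \<Rightarrow> real^'n"
    where f: "orthogonal_transformation f" "f x = norm x *\<^sub>R axis i0 1"
    using orthogonal_transformation_exists by metis
  define Q where "Q = matrix f"
  have Qx: "Q *v x = norm x *\<^sub>R axis i0 1"
    unfolding Q_def using f
    by (simp add: matrix_works orthogonal_transformation_def)
  have Q: "orthogonal_matrix Q"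
    unfolding Q_def using f(1) orthogonal_transformation_matrix by blast
  have "det (mat t - (p *\<^sub>R mat 1 + q *\<^sub>R outer x x)) =
      (\<Prod>i\<in>UNIV. t - (\<chi> i. if i = i0 then p + q * (x \<bullet> x) else p) $ i)" for t
  proof -
    let ?M = "mat t - (p *\<^sub>R mat 1 + q *\<^sub>R outer x x)"
    let ?D = "\<chi> i j. if i = j then t - (if i = i0 then p + q * (x \<bullet> x) else p) else 0"
    have M: "?M = (t - p) *\<^sub>R mat 1 - q *\<^sub>R outer x x"
      by (simp add: vec_eq_iff mat_def algebra_simps)
    have diff: "A ** (B - C) = A ** B - A ** C" "(B - C) ** A = B ** A - C ** A"
      for A B C :: "real^'n^'n"
      by (simp_all add: vec_eq_iff matrix_matrix_mult_def algebra_simps sum_subtractf)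
    have "Q ** ?M ** transpose Q =
        (t - p) *\<^sub>R (Q ** transpose Q) - q *\<^sub>R outer (Q *v x) (Q *v x)"
      unfolding M conjugate_outer[symmetric] diff
      by (simp add: matrix_scalar_ac scalar_matrix_assoc[symmetric])
    also have "Q ** transpose Q = mat 1"
      using Q by (simp add: orthogonal_matrix_def)
    also have "(t - p) *\<^sub>R mat 1 - q *\<^sub>R outer (Q *v x) (Q *v x) = ?D"
      unfolding Qx
      by (auto simp: vec_eq_iff mat_def outer_def axis_def power2_norm_eq_inner[symmetric]
          power2_eq_square algebra_simps)
    finally have conj: "Q ** ?M ** transpose Q = ?D" .
    have "det Q * det Q = 1"
      using det_orthogonal_matrix[OF Q] by auto
    then have "det (Q ** ?M ** transpose Q) = det ?M"
      by (simp add: det_mul det_transpose mult.commute mult.left_commute)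
    then have "det ?M = det ?D" using conj by simp
    also have "\<dots> = (\<Prod>i\<in>UNIV. ?D $ i $ i)"
      by (rule det_diagonal) simp
    finally show ?thesis by simp
  qed
  then show ?thesis unfolding eigenvalue_vectors_def by blast
qed

section \<open>Radial functions and their Schouten tensor\<close>

text \<open>
  A radial function is written as \<open>G (x \<bullet> x)\<close>, with a profile in the squared radius: \<open>x \<bullet> x\<close> is
  polynomial in the coordinates, so no derivative of the norm is needed.
\<close>

locale radial_C2 =
  fixes G G' G'' :: "real \<Rightarrow> real"
  assumes deriv1: "0 < s \<Longrightarrow> (G has_real_derivative G' s) (at s)"
    and deriv2: "0 < s \<Longrightarrow> (G' has_real_derivative G'' s) (at s)"
    and cont2: "continuous_on {0<..} G''"
begin

lemma cont0: "continuous_on {0<..} G" and cont1: "continuous_on {0<..} G'"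
  using deriv1 deriv2
  by (auto intro!: continuous_at_imp_continuous_on DERIV_isCont)

lemma has_derivative_radial:
  fixes x :: "real^'n"
  assumes "x \<noteq> 0"
  shows "((\<lambda>x. G (x \<bullet> x)) has_derivative (\<lambda>h. 2 * G' (x \<bullet> x) * (x \<bullet> h))) (at x)"
proof -
  have "((\<lambda>x. x \<bullet> x) has_derivative (\<lambda>h. x \<bullet> h + h \<bullet> x)) (at x)"
    by (rule has_derivative_inner) auto
  moreover have "(G has_derivative (*) (G' (x \<bullet> x))) (at (x \<bullet> x))"
    using deriv1[of "x \<bullet> x"] assms by (simp add: has_field_derivative_def)
  ultimately show ?thesis
    by (rule has_derivative_compose[THEN has_derivative_eq_rhs])
      (auto simp: inner_commute algebra_simps)
qed

lemma partial_deriv_radial: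
  fixes x :: "real^'n"
  assumes "x \<noteq> 0"
  shows "partial_deriv i (\<lambda>x. G (x \<bullet> x)) x = 2 * G' (x \<bullet> x) * x $ i"
  unfolding partial_deriv_def frechet_derivative_at[OF has_derivative_radial[OF assms], symmetric]
  by (simp add: inner_axis)

lemma has_derivative_partial_radial:
  fixes x :: "real^'n"
  assumes "x \<noteq> 0"
  shows "(partial_deriv j (\<lambda>x. G (x \<bullet> x)) has_derivative
    (\<lambda>h. 2 * G' (x \<bullet> x) * h $ j + 4 * G'' (x \<bullet> x) * (x \<bullet> h) * x $ j)) (at x)"
proof -
  have "((\<lambda>x. x \<bullet> x) has_derivative (\<lambda>h. x \<bullet> h + h \<bullet> x)) (at x)"
    by (rule has_derivative_inner) auto
  moreover have "(G' has_derivative (*) (G'' (x \<bullet> x))) (at (x \<bullet> x))"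
    using deriv2[of "x \<bullet> x"] assms by (simp add: has_field_derivative_def)
  ultimately have "((\<lambda>x. G' (x \<bullet> x)) has_derivative
      (\<lambda>h. G'' (x \<bullet> x) * (x \<bullet> h + h \<bullet> x))) (at x)"
    by (rule has_derivative_compose)
  moreover have "((\<lambda>x. x $ j) has_derivative (\<lambda>h. h $ j)) (at x)"
    by (rule bounded_linear_imp_has_derivative) (rule bounded_linear_vec_nth)
  ultimately have "((\<lambda>x. 2 * (G' (x \<bullet> x) * x $ j)) has_derivative
      (\<lambda>h. 2 * (G' (x \<bullet> x) * h $ j + G'' (x \<bullet> x) * (x \<bullet> h + h \<bullet> x) * x $ j))) (at x)"
    by (intro has_derivative_mult_right has_derivative_mult)
  then have "((\<lambda>x. 2 * G' (x \<bullet> x) * x $ j) has_derivative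
      (\<lambda>h. 2 * G' (x \<bullet> x) * h $ j + 4 * G'' (x \<bullet> x) * (x \<bullet> h) * x $ j)) (at x)"
    by (simp add: inner_commute algebra_simps)
  then show ?thesis
    by (rule has_derivative_transform_within_open[where s = "- {0}"])
      (use assms in \<open>auto simp: partial_deriv_radial open_Compl\<close>)
qed

lemma partial_deriv2_radial:
  fixes x :: "real^'n"
  assumes "x \<noteq> 0"
  shows "partial_deriv i (partial_deriv j (\<lambda>x. G (x \<bullet> x))) x =
    2 * G' (x \<bullet> x) * (if i = j then 1 else 0) + 4 * G'' (x \<bullet> x) * (x $ i * x $ j)"
  unfolding partial_deriv_def[of i]
    frechet_derivative_at[OF has_derivative_partial_radial[OF assms], symmetric]
  by (auto simp: inner_axis) (auto simp: axis_def)

lemma C2_on_radial: "C2_on (- {0}) (\<lambda>x :: real^'n. G (x \<bullet> x))"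
proof -
  have 1: "continuous_on (- {0}) (\<lambda>x :: real^'n. G' (x \<bullet> x))"
    using cont1 by (rule continuous_on_compose2) (auto intro!: continuous_intros)
  have 2: "continuous_on (- {0}) (\<lambda>x :: real^'n. G'' (x \<bullet> x))"
    using cont2 by (rule continuous_on_compose2) (auto intro!: continuous_intros)
  have "continuous_on (- {0}) (\<lambda>x :: real^'n.
      2 * G' (x \<bullet> x) * (if i = j then 1 else 0) + 4 * G'' (x \<bullet> x) * (x $ i * x $ j))" for i j
    by (intro continuous_intros 1 2)
  then have "continuous_on (- {0}) (partial_deriv i (partial_deriv j (\<lambda>x :: real^'n. G (x \<bullet> x))))"
    for i j
    by (subst continuous_on_cong[OF refl partial_deriv2_radial]) auto
  moreover have "(\<lambda>x :: real^'n. G (x \<bullet> x)) differentiable_on - {0}"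
    by (rule differentiable_at_imp_differentiable_on)
      (use has_derivative_radial in \<open>auto simp: differentiable_def\<close>)
  moreover have "partial_deriv i (\<lambda>x :: real^'n. G (x \<bullet> x)) differentiable_on - {0}" for i
    by (rule differentiable_at_imp_differentiable_on)
      (use has_derivative_partial_radial in \<open>auto simp: differentiable_def\<close>)
  ultimately show ?thesis unfolding C2_on_def by (simp add: open_Compl)
qed

lemma radial_C2_exp:
  "radial_C2 (\<lambda>s. exp (- m * G s)) (\<lambda>s. - m * G' s * exp (- m * G s))
    (\<lambda>s. (m\<^sup>2 * (G' s)\<^sup>2 - m * G'' s) * exp (- m * G s))"
proof
  fix s :: real assume "0 < s"
  note d = deriv1[OF this] deriv2[OF this]
  show "((\<lambda>s. exp (- m * G s)) has_real_derivative - m * G' s * exp (- m * G s)) (at s)"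
    by (rule derivative_eq_intros d refl | simp)+
  show "((\<lambda>s. - m * G' s * exp (- m * G s)) has_real_derivative
      (m\<^sup>2 * (G' s)\<^sup>2 - m * G'' s) * exp (- m * G s)) (at s)"
    by (rule derivative_eq_intros d refl | simp add: algebra_simps power2_eq_square)+
next
  show "continuous_on {0<..} (\<lambda>s. (m\<^sup>2 * (G' s)\<^sup>2 - m * G'' s) * exp (- m * G s))"
    by (intro continuous_intros cont0 cont1 cont2)
qed

text \<open>
  For \<open>u = exp (- m * w)\<close> the powers of \<open>u\<close> in the Schouten tensor combine to
  \<open>exp (2 * w) * (\<nabla>\<^sup>2 w + dw \<otimes> dw - |dw|\<^sup>2 / 2 * I)\<close>, which contains no dimensional constants.
\<close>

lemma schouten_radial_exp:
  fixes x :: "real^'n"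
  assumes "x \<noteq> 0" "2 < CARD('n)"
  defines "m \<equiv> (real CARD('n) - 2) / 2"
  defines "s \<equiv> x \<bullet> x"
  shows "schouten (\<lambda>x. exp (- m * G (x \<bullet> x))) x =
      (exp (2 * G s) * (2 * G' s * (1 - s * G' s))) *\<^sub>R mat 1
      + (4 * exp (2 * G s) * (G'' s + (G' s)\<^sup>2)) *\<^sub>R outer x x"
proof -
  interpret E: radial_C2 "\<lambda>s. exp (- m * G s)" "\<lambda>s. - m * G' s * exp (- m * G s)"
    "\<lambda>s. (m\<^sup>2 * (G' s)\<^sup>2 - m * G'' s) * exp (- m * G s)"
    by (rule radial_C2_exp)
  define \<phi> where "\<phi> = (\<lambda>x :: real^'n. exp (- m * G (x \<bullet> x)))"
  define e where "e = exp (- m * G s)"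
  have m: "0 < m" "real CARD('n) = 2 * m + 2"
    using assms(2) by (auto simp: m_def field_simps)
  have "\<phi> x powr (- (real CARD('n) + 2) / (real CARD('n) - 2)) =
      exp (((m + 2) / m) * (m * G s))"
    unfolding \<phi>_def s_def[symmetric] powr_def using m by (simp add: field_simps)
  also have "((m + 2) / m) * (m * G s) = m * G s + 2 * G s"
    using m(1) by (simp add: field_simps)
  finally have P1: "\<phi> x powr (- (real CARD('n) + 2) / (real CARD('n) - 2)) * e = exp (2 * G s)"
    unfolding e_def by (simp add: exp_add[symmetric])
  have "\<phi> x powr (- 2 * real CARD('n) / (real CARD('n) - 2)) =
      exp ((2 * (m + 1) / m) * (m * G s))"
    unfolding \<phi>_def s_def[symmetric] powr_def using m by (simp add: field_simps)
  also have "(2 * (m + 1) / m) * (m * G s) = 2 * (m * G s) + 2 * G s"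
    using m(1) by (simp add: field_simps)
  finally have P2: "\<phi> x powr (- 2 * real CARD('n) / (real CARD('n) - 2)) * e\<^sup>2 = exp (2 * G s)"
    unfolding e_def by (simp add: exp_add[symmetric] power2_eq_square)
  have g: "grad \<phi> x = (- 2 * m * G' s * e) *\<^sub>R x"
    unfolding grad_def \<phi>_def E.partial_deriv_radial[OF assms(1)] e_def s_def
    by (simp add: vec_eq_iff)
  have ng: "(norm (grad \<phi> x))\<^sup>2 = 4 * m\<^sup>2 * (G' s)\<^sup>2 * s * e\<^sup>2"
    unfolding g s_def power2_norm_eq_inner
    by (simp add: power2_eq_square)
  have h: "hessian \<phi> x $ i $ j = (- 2 * m * G' s * (if i = j then 1 else 0)
      + 4 * (m\<^sup>2 * (G' s)\<^sup>2 - m * G'' s) * (x $ i * x $ j)) * e" for i j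
    unfolding hessian_def \<phi>_def E.partial_deriv2_radial[OF assms(1)] e_def s_def
    by (simp add: algebra_simps)
  show "schouten (\<lambda>x. exp (- m * G (x \<bullet> x))) x =
      (exp (2 * G s) * (2 * G' s * (1 - s * G' s))) *\<^sub>R mat 1
      + (4 * exp (2 * G s) * (G'' s + (G' s)\<^sup>2)) *\<^sub>R outer x x"
  proof (simp only: vec_eq_iff, intro allI)
    fix i j
    define X where "X = x $ i * x $ j"
    define d where "d = (if i = j then 1 else 0 :: real)"
    define p1 where "p1 = \<phi> x powr (- (real CARD('n) + 2) / (real CARD('n) - 2))"
    define p2 where "p2 = \<phi> x powr (- 2 * real CARD('n) / (real CARD('n) - 2))"
    have n2: "2 / (real CARD('n) - 2) = 1 / m" "2 / (real CARD('n) - 2)\<^sup>2 = 1 / (2 * m\<^sup>2)"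
      "2 * real CARD('n) / (real CARD('n) - 2)\<^sup>2 = (m + 1) / m\<^sup>2"
      using m by (auto simp: power2_eq_square field_simps)
    have "schouten \<phi> x $ i $ j =
        - (1 / m) * p1 * ((- 2 * m * G' s * d + 4 * (m\<^sup>2 * (G' s)\<^sup>2 - m * G'' s) * X) * e)
        + (m + 1) / m\<^sup>2 * p2 * (4 * m\<^sup>2 * (G' s)\<^sup>2 * e\<^sup>2 * X)
        - 1 / (2 * m\<^sup>2) * p2 * (4 * m\<^sup>2 * (G' s)\<^sup>2 * s * e\<^sup>2) * d"
      unfolding schouten_def Let_def p1_def p2_def ng n2[symmetric] d_def X_def
      by (simp add: h g outer_def mat_def power2_eq_square mult_ac)
    also have "\<dots> = (2 * G' s * d + 4 * (G'' s - m * (G' s)\<^sup>2) * X) * (p1 * e)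
        + (4 * (m + 1) * (G' s)\<^sup>2 * X) * (p2 * e\<^sup>2) - 2 * (G' s)\<^sup>2 * s * d * (p2 * e\<^sup>2)"
      using m(1) by (simp add: field_simps power2_eq_square)
    also have "\<dots> = exp (2 * G s) * (2 * G' s * (1 - s * G' s)) * d
        + 4 * exp (2 * G s) * (G'' s + (G' s)\<^sup>2) * X"
      using P1 P2 unfolding p1_def[symmetric] p2_def[symmetric]
      by (simp add: algebra_simps power2_eq_square)
    finally show "schouten (\<lambda>x. exp (- m * G (x \<bullet> x))) x $ i $ j =
        ((exp (2 * G s) * (2 * G' s * (1 - s * G' s))) *\<^sub>R mat 1
          + (4 * exp (2 * G s) * (G'' s + (G' s)\<^sup>2)) *\<^sub>R outer x x) $ i $ j"
      unfolding \<phi>_def d_def X_def by (simp add: mat_def outer_def)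
  qed
qed

text \<open>
  Assumption \<open>tang\<close> concerns the tangential eigenvalue. In the sum of the tangential and the radial
  eigenvalue the terms quadratic in \<open>G'\<close> cancel, which leaves the multiple of \<open>(s * G' s)'\<close> in
  assumption \<open>sum\<close>.
\<close>

lemma schouten_radial_meets_U_set:
  fixes x :: "real^'n"
  assumes "x \<noteq> 0" "CARD('n) = 2 * k" "2 \<le> k"
  defines "m \<equiv> (real CARD('n) - 2) / 2"
  defines "s \<equiv> x \<bullet> x"
  assumes tang: "1 < exp (2 * G s) * (2 * G' s * (1 - s * G' s))"
    and sum: "1 < 4 * exp (2 * G s) * (G' s + s * G'' s)"
  shows "\<not> eigenvalue_vectors (schouten (\<lambda>x. exp (- m * G (x \<bullet> x))) x) \<subseteq> UNIV - U_set"
proof -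
  define p where "p = exp (2 * G s) * (2 * G' s * (1 - s * G' s))"
  define q where "q = 4 * exp (2 * G s) * (G'' s + (G' s)\<^sup>2)"
  \<comment> \<open>The eigenvalues are unordered, so any index can carry the radial one.\<close>
  define l where "l = (\<chi> i :: 'n. if i = undefined then p + q * s else p)"
  have "schouten (\<lambda>x. exp (- m * G (x \<bullet> x))) x = p *\<^sub>R mat 1 + q *\<^sub>R outer x x"
    using schouten_radial_exp[OF assms(1)] assms(2,3) unfolding p_def q_def s_def m_def by simp
  then have "l \<in> eigenvalue_vectors (schouten (\<lambda>x. exp (- m * G (x \<bullet> x))) x)"
    using eigenvalue_vector_scalar_plus_outer[of undefined p q x]
    unfolding l_def s_def by simp
  moreover have "(p + q * s) + p = 4 * exp (2 * G s) * (G' s + s * G'' s)"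
    unfolding p_def q_def by (simp add: algebra_simps power2_eq_square)
  then have "l \<in> U_set"
    unfolding l_def using assms(2,3) tang sum by (intro spike_in_U_set) (auto simp: p_def)
  ultimately show ?thesis by blast
qed

end

section \<open>The barrier\<close>

text \<open>
  This is \<open>w_a\<close> as a function of the squared radius \<open>s\<close>. The logarithm alone is affine in the
  logarithmic radius and gives \<open>A + b = 0\<close>; the power term supplies the convexity. That convexity
  decays like \<open>z powr \<alpha>\<close> at the origin, but the factor \<open>exp (2 * \<xi>)\<close> grows like
  \<open>z powr (- 2 * a)\<close>, and \<open>\<alpha> \<le> 2 * a\<close> makes this enough for every \<open>a\<close>.
\<close>

definition barrier_profile :: "real \<Rightarrow> real \<Rightarrow> real \<Rightarrow> real \<Rightarrow> real \<Rightarrow> real" where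
  "barrier_profile c r \<alpha> a s =
     c + (1 - a) * (ln s / 2 - ln r) + s powr (\<alpha> / 2) / (2 * r powr \<alpha>)"

definition barrier_profile' :: "real \<Rightarrow> real \<Rightarrow> real \<Rightarrow> real \<Rightarrow> real" where
  "barrier_profile' r \<alpha> a s =
     (1 - a) / (2 * s) + \<alpha> / 4 * s powr (\<alpha> / 2 - 1) / r powr \<alpha>"

definition barrier_profile'' :: "real \<Rightarrow> real \<Rightarrow> real \<Rightarrow> real \<Rightarrow> real" where
  "barrier_profile'' r \<alpha> a s =
     - (1 - a) / (2 * s\<^sup>2) + \<alpha> / 4 * (\<alpha> / 2 - 1) * s powr (\<alpha> / 2 - 2) / r powr \<alpha>"

lemma radial_C2_barrier:
  assumes "0 < r"
  shows "radial_C2 (barrier_profile c r \<alpha> a) (barrier_profile' r \<alpha> a) (barrier_profile'' r \<alpha> a)"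
proof
  fix s :: real assume s: "0 < s"
  show "(barrier_profile c r \<alpha> a has_real_derivative barrier_profile' r \<alpha> a s) (at s)"
    unfolding barrier_profile_def[abs_def] barrier_profile'_def using s assms
    by (auto intro!: derivative_eq_intros simp: field_simps)
  show "(barrier_profile' r \<alpha> a has_real_derivative barrier_profile'' r \<alpha> a s) (at s)"
    unfolding barrier_profile'_def[abs_def] barrier_profile''_def using s assms
    by (auto intro!: derivative_eq_intros simp: field_simps power2_eq_square)
next
  show "continuous_on {0<..} (barrier_profile'' r \<alpha> a)"
    unfolding barrier_profile''_def[abs_def] using assms by (auto intro!: continuous_intros)
qed

lemma barrier_profile_norm:
  fixes x :: "real^'n"
  assumes "x \<noteq> 0" "0 < r"
  shows "barrier_profile c r \<alpha> a (x \<bullet> x) =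
    c + (1 - a) * ln (norm x / r) + (norm x / r) powr \<alpha> / 2"
proof -
  have "x \<bullet> x = norm x powr 2"
    using assms by (simp add: power2_norm_eq_inner[symmetric])
  then show ?thesis
    unfolding barrier_profile_def using assms
    by (simp add: powr_powr ln_powr ln_div powr_divide del: powr_numeral)
qed

text \<open>
  With \<open>P = s * W'\<close> and \<open>y = z powr \<alpha>\<close>, the tangential eigenvalue is \<open>E / s * 2 * P * (1 - P)\<close>
  and its sum with the radial one is \<open>4 * E / s * (s * P')\<close>, where \<open>E = exp (2 * W)\<close>. Both are
  bounded below by a multiple of \<open>E / s * y\<close>, because \<open>\<alpha> * y / 4 \<le> P \<le> 1 / 2\<close> and
  \<open>s * P' = \<alpha>\<^sup>2 * y / 8\<close>. No factor \<open>1 - a\<close> appears in these bounds, which is what allows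
  \<open>a\<close> to approach 1.
\<close>

lemma barrier_meets_U_set:
  fixes x :: "real^'n"
  assumes n: "even CARD('n)" "4 \<le> CARD('n)"
    and \<alpha>: "0 < \<alpha>" "\<alpha> \<le> 1" and a: "\<alpha> / 2 \<le> a" "a \<le> 1"
    and x: "0 < norm x" "norm x \<le> r"
    and c: "4 / \<alpha>\<^sup>2 < exp (2 * c) / r\<^sup>2"
  defines "m \<equiv> (real CARD('n) - 2) / 2"
  shows "\<not> eigenvalue_vectors (schouten (\<lambda>x. exp (- m * barrier_profile c r \<alpha> a (x \<bullet> x))) x)
    \<subseteq> UNIV - U_set"
proof -
  have r: "0 < r" using x by linarith
  interpret radial_C2 "barrier_profile c r \<alpha> a" "barrier_profile' r \<alpha> a" "barrier_profile'' r \<alpha> a"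
    by (rule radial_C2_barrier[OF r])
  define s where "s = x \<bullet> x"
  define z where "z = norm x / r"
  define y where "y = z powr \<alpha>"
  define E where "E = exp (2 * barrier_profile c r \<alpha> a s)"
  define P where "P = s * barrier_profile' r \<alpha> a s"
  define Q where "Q = s * (barrier_profile' r \<alpha> a s + s * barrier_profile'' r \<alpha> a s)"
  have z: "0 < z" "z \<le> 1" using x r by (auto simp: z_def)
  have y: "0 < y" "y \<le> 1" unfolding y_def using z \<alpha> by (auto simp: powr_le1)
  have s: "0 < s" "s = norm x powr 2" "s = (norm x)\<^sup>2" using x
    by (auto simp: s_def power2_norm_eq_inner[symmetric])
  have sy: "s powr (\<alpha> / 2) / r powr \<alpha> = y"
    unfolding y_def z_def s(2) using x r by (simp add: powr_powr powr_divide del: powr_numeral)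
  have s1: "s powr (\<alpha> / 2 - 1) = s powr (\<alpha> / 2) / s"
    using s(1) by (simp add: powr_diff)
  have s2: "s powr (\<alpha> / 2 - 2) = s powr (\<alpha> / 2) / s\<^sup>2"
    using s(1) by (simp add: powr_diff)
  have P: "P = (1 - a) / 2 + \<alpha> / 4 * y"
    unfolding P_def barrier_profile'_def s1 sy[symmetric] using s(1) r by (simp add: field_simps)
  have Q: "Q = \<alpha>\<^sup>2 / 8 * y"
    unfolding Q_def barrier_profile'_def barrier_profile''_def s1 s2 sy[symmetric] using s(1) r
    by (simp add: field_simps power2_eq_square)
  \<comment> \<open>\<open>E / s\<close> is at least a multiple of \<open>z powr (- 2 * a)\<close>, and \<open>\<alpha> \<le> 2 * a\<close> makes this at least
    the same multiple of \<open>1 / y\<close>.\<close>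
  have E: "4 / \<alpha>\<^sup>2 < E / s * y"
  proof -
    have "E = exp (2 * c) * z powr (2 * (1 - a)) * exp y"
      unfolding E_def s_def barrier_profile_norm[OF x(1)[unfolded zero_less_norm_iff] r]
        z_def[symmetric] y_def[symmetric]
      using z(1) by (simp add: powr_def exp_add[symmetric] algebra_simps)
    moreover have "s = r\<^sup>2 * z powr 2"
      using s(3) r z by (simp add: z_def power_divide)
    ultimately have "E / s * y = exp (2 * c) / r\<^sup>2 * (z powr (2 * (1 - a)) / z powr 2 * y * exp y)"
      by simp
    also have "z powr (2 * (1 - a)) / z powr 2 * y = z powr (\<alpha> - 2 * a)"
      unfolding y_def powr_diff[symmetric] powr_add[symmetric] by (simp add: algebra_simps)
    also have "exp (2 * c) / r\<^sup>2 * (z powr (\<alpha> - 2 * a) * exp y) \<ge> exp (2 * c) / r\<^sup>2 * (1 * 1)"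
    proof (intro mult_left_mono mult_mono)
      show "1 \<le> z powr (\<alpha> - 2 * a)"
        using powr_mono'[of "\<alpha> - 2 * a" 0 z] z a by simp
    qed (use y in auto)
    finally show ?thesis using c by simp
  qed
  show ?thesis
    unfolding m_def
  proof (rule schouten_radial_meets_U_set)
    show "x \<noteq> 0" "CARD('n) = 2 * (CARD('n) div 2)" "2 \<le> CARD('n) div 2"
      using x n by auto
    have "\<alpha> * y \<le> \<alpha>"
      using y \<alpha> by (simp add: mult_left_le)
    then have P2: "\<alpha> / 4 * y \<le> P" "P \<le> 1 / 2"
      using a unfolding P by (auto simp: field_simps)
    have P0: "0 \<le> P"
      using a y \<alpha> unfolding P by simp
    have "1 \<le> \<alpha> / 4 * (4 / \<alpha>\<^sup>2)"
      using \<alpha> by (simp add: power2_eq_square)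
    also have "\<dots> < \<alpha> / 4 * (E / s * y)"
      using E \<alpha> by (intro mult_strict_left_mono) auto
    also have "\<dots> = E / s * (\<alpha> / 4 * y * (2 * (1 - 1 / 2)))" by (simp add: mult_ac)
    also have "\<dots> \<le> E / s * (P * (2 * (1 - P)))"
      using P0 P2 s(1) y \<alpha> by (intro mult_left_mono mult_mono) (auto simp: E_def)
    also have "\<dots> = E * (2 * barrier_profile' r \<alpha> a s * (1 - P))"
      unfolding P_def using s(1) by simp
    finally show "1 < exp (2 * barrier_profile c r \<alpha> a (x \<bullet> x)) *
        (2 * barrier_profile' r \<alpha> a (x \<bullet> x) * (1 - x \<bullet> x * barrier_profile' r \<alpha> a (x \<bullet> x)))"
      unfolding P_def E_def s_def .
    have "1 < \<alpha>\<^sup>2 / 2 * (4 / \<alpha>\<^sup>2)"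
      using \<alpha> by simp
    also have "\<dots> < \<alpha>\<^sup>2 / 2 * (E / s * y)"
      using E \<alpha> by (intro mult_strict_left_mono) auto
    also have "\<dots> = 4 * (E / s * Q)" unfolding Q by simp
    finally show "1 < 4 * exp (2 * barrier_profile c r \<alpha> a (x \<bullet> x)) *
        (barrier_profile' r \<alpha> a (x \<bullet> x) + x \<bullet> x * barrier_profile'' r \<alpha> a (x \<bullet> x))"
      unfolding Q_def E_def s_def[symmetric] using s(1) by simp
  qed
qed

section \<open>Comparison\<close>

text \<open>
  The pairs with a nonpositive value form a compact set, and the contact is at a pair with least
  parameter. A negative value at that parameter would, by the intermediate value theorem, be preceded
  by a zero at a smaller one.
\<close>

lemma first_contact:
  fixes D :: "real \<Rightarrow> 'a::metric_space \<Rightarrow> real"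
  assumes "compact K" and cont: "continuous_on ({a0..a1} \<times> K) (\<lambda>(a, x). D a x)"
    and start: "\<And>x. x \<in> K \<Longrightarrow> 0 < D a0 x"
    and "a0 \<le> a1" "z \<in> K" "D a1 z \<le> 0"
  obtains a x where "a0 \<le> a" "a \<le> a1" "x \<in> K" "D a x = 0" "\<And>y. y \<in> K \<Longrightarrow> 0 \<le> D a y"
proof -
  define Z where "Z = ({a0..a1} \<times> K) \<inter> (\<lambda>(a, x). D a x) -` {..0}"
  have S: "compact ({a0..a1} \<times> K)"
    using assms(1) by (intro compact_Times) auto
  have "closed Z"
    unfolding Z_def using cont S compact_imp_closed by (intro continuous_closed_preimage) auto
  then have "compact ({a0..a1} \<times> K \<inter> Z)"
    using S by (rule compact_Int_closed[rotated])
  then have "compact Z" by (simp add: Z_def Int_assoc[symmetric])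
  moreover have "(a1, z) \<in> Z" using assms by (auto simp: Z_def)
  ultimately obtain p where p: "p \<in> Z" and least: "\<And>q. q \<in> Z \<Longrightarrow> fst p \<le> fst q"
    using continuous_attains_inf[of Z fst] continuous_on_fst[OF continuous_on_id] by (metis empty_iff)
  obtain a x where ax: "p = (a, x)" by fastforce
  then have a: "a0 \<le> a" "a \<le> a1" and x: "x \<in> K" "D a x \<le> 0"
    using p by (auto simp: Z_def)
  have nonneg: "0 \<le> D a y" if "y \<in> K" for y
  proof (rule ccontr)
    assume neg: "\<not> 0 \<le> D a y"
    have "continuous_on {a0..a} (\<lambda>b. (\<lambda>(a, x). D a x) (b, y))"
      using a that by (intro continuous_on_compose2[OF cont]) (auto intro!: continuous_intros)
    then have "\<exists>b\<ge>a0. b \<le> a \<and> D b y = 0"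
      using start[OF that] neg a(1) by (intro IVT2') auto
    then obtain b where b: "a0 \<le> b" "b \<le> a" "D b y = 0" by blast
    then have "(b, y) \<in> Z" using a that by (auto simp: Z_def)
    from least[OF this] b neg show False unfolding ax by auto
  qed
  show ?thesis
    using that[OF a x(1)] nonneg x by force
qed

text \<open>
  A first contact with a barrier of parameter at most \<open>a\<close> is excluded everywhere: near the origin by the boundedness of \<open>u\<close>,
  on the sphere of radius \<open>r\<close> because all barriers agree there, and in between by the viscosity
  condition.
\<close>

lemma subsolution_below_barrier:
  fixes u :: "real^'n \<Rightarrow> real"
  defines "m \<equiv> (real CARD('n) - 2) / 2"
  defines "\<phi> \<equiv> \<lambda>c r \<alpha> a (x :: real^'n). exp (- m * barrier_profile c r \<alpha> a (x \<bullet> x))"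
  assumes n: "even CARD('n)" "4 \<le> CARD('n)"
    and \<alpha>: "0 < \<alpha>" "\<alpha> \<le> 1" and r: "0 < r" "r < 1"
    and c: "4 / \<alpha>\<^sup>2 < exp (2 * c) / r\<^sup>2"
    and cont: "continuous_on (cball 0 1 - {0}) u"
    and visc: "visc_outside_U (ball 0 1 - {0}) u"
    and limsup: "Limsup (at 0) (\<lambda>x. ereal (u x)) < \<infinity>"
    and start: "\<And>x. 0 < norm x \<Longrightarrow> norm x \<le> r \<Longrightarrow> u x < \<phi> c r \<alpha> (\<alpha> / 2) x"
    and a: "\<alpha> / 2 \<le> a" "a < 1" and x: "0 < norm x" "norm x \<le> r"
  shows "u x < \<phi> c r \<alpha> a x"
proof (rule ccontr)
  assume contact: "\<not> u x < \<phi> c r \<alpha> a x"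
  have m: "0 < m" using n by (simp add: m_def)
  obtain B0 where "Limsup (at 0) (\<lambda>x. ereal (u x)) < ereal B0"
    using ereal_dense2[OF limsup] by blast
  then have "\<forall>\<^sub>F x in at 0. ereal (u x) < ereal B0"
    by (rule Limsup_lessD)
  then obtain d where d: "0 < d" "\<And>x. x \<noteq> 0 \<Longrightarrow> norm x < d \<Longrightarrow> u x < B0"
    by (auto simp: eventually_at)
  \<comment> \<open>The condition \<open>ln (norm y / r) \<le> - h\<close> makes \<open>\<phi>\<close> at least \<open>B\<close> for all parameters up to
    \<open>a\<close>. The maximum with 1 only serves to make the logarithm of \<open>B\<close> meaningful.\<close>
  define B where "B = max B0 1"
  define h where "h = (c + 1 / 2 + ln B / m) / (1 - a)"
  define \<delta> where "\<delta> = min (d / 2) (r * exp (- h))"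
  have \<delta>: "0 < \<delta>" using d(1) r by (simp add: \<delta>_def)
  have near0: "u y < \<phi> c r \<alpha> b y"
    if b: "\<alpha> / 2 \<le> b" "b \<le> a" and y: "0 < norm y" "norm y \<le> \<delta>" "norm y \<le> r" for b y
  proof -
    define t where "t = norm y / r"
    have "t \<le> exp (- h)"
      using y(2) r by (simp add: t_def \<delta>_def field_simps)
    moreover have t: "0 < t" "t \<le> 1"
      using y r by (auto simp: t_def)
    ultimately have lnt: "ln t \<le> - h" "ln t \<le> 0"
      using ln_le_cancel_iff[of t "exp (- h)"] by auto
    have "barrier_profile c r \<alpha> b (y \<bullet> y) = c + (1 - b) * ln t + t powr \<alpha> / 2"
      using barrier_profile_norm[of y r] y r by (simp add: t_def)
    also have "\<dots> \<le> c + (1 - a) * ln t + 1 / 2"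
      using b lnt t \<alpha> mult_right_mono_neg[of "1 - a" "1 - b" "ln t"] powr_le1[of \<alpha> t] by simp
    also have "\<dots> \<le> c + (1 - a) * (- h) + 1 / 2"
      using mult_left_mono[OF lnt(1), of "1 - a"] a by simp
    also have "\<dots> = - (ln B / m)"
      using a by (simp add: h_def)
    finally have "ln B \<le> - m * barrier_profile c r \<alpha> b (y \<bullet> y)"
      using m by (simp add: field_simps)
    then have "exp (ln B) \<le> \<phi> c r \<alpha> b y"
      unfolding \<phi>_def by (rule exp_le_cancel_iff[THEN iffD2])
    then have "B \<le> \<phi> c r \<alpha> b y" by (simp add: B_def)
    moreover have "u y < B0"
      using y d by (intro d(2)) (auto simp: \<delta>_def)
    ultimately show ?thesis by (simp add: B_def)
  qed
  define K where "K = cball 0 r - ball (0 :: real^'n) \<delta>"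
  have K: "y \<in> K \<longleftrightarrow> \<delta> \<le> norm y \<and> norm y \<le> r" for y by (auto simp: K_def)
  have "compact K" unfolding K_def by (intro compact_diff) auto
  moreover have "continuous_on ({\<alpha> / 2..a} \<times> K) (\<lambda>(b, y). \<phi> c r \<alpha> b y - u y)"
  proof -
    have "continuous_on ({\<alpha> / 2..a} \<times> K) (\<lambda>p. u (snd p))"
      using \<delta> r by (intro continuous_on_compose2[OF cont] continuous_intros) (auto simp: K)
    moreover have "continuous_on ({\<alpha> / 2..a} \<times> K) (\<lambda>p. \<phi> c r \<alpha> (fst p) (snd p))"
      unfolding \<phi>_def barrier_profile_def using \<delta> r
      by (intro continuous_intros) (auto simp: K)
    ultimately show ?thesis
      by (simp add: case_prod_unfold continuous_on_diff)
  qed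
  moreover have "0 < \<phi> c r \<alpha> (\<alpha> / 2) y - u y" if "y \<in> K" for y
    using start[of y] that \<delta> unfolding K by linarith
  moreover have "\<not> norm x \<le> \<delta>"
    using near0[OF a(1) order.refl x(1) _ x(2)] contact by blast
  then have "x \<in> K" using x unfolding K by simp
  moreover have "\<phi> c r \<alpha> a x - u x \<le> 0" using contact by simp
  ultimately obtain b y where b: "\<alpha> / 2 \<le> b" "b \<le> a" and y: "y \<in> K"
    and eq: "\<phi> c r \<alpha> b y - u y = 0" and above: "\<And>y. y \<in> K \<Longrightarrow> 0 \<le> \<phi> c r \<alpha> b y - u y"
    using first_contact[of K "\<alpha> / 2" a "\<lambda>b y. \<phi> c r \<alpha> b y - u y" x thesis] a(1) by simp
  have "norm y \<noteq> r"
  proof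
    assume yr: "norm y = r"
    then have "\<phi> c r \<alpha> b y = \<phi> c r \<alpha> (\<alpha> / 2) y"
      unfolding \<phi>_def using barrier_profile_norm[of y r] r by auto
    then show False using start[of y] yr r eq by simp
  qed
  moreover have "norm y \<noteq> \<delta>"
    using near0[OF b, of y] y eq \<delta> unfolding K by auto
  ultimately have y: "\<delta> < norm y" "norm y < r" using y unfolding K by auto
  interpret radial_C2 "barrier_profile c r \<alpha> b" "barrier_profile' r \<alpha> b" "barrier_profile'' r \<alpha> b"
    by (rule radial_C2_barrier[OF r(1)])
  have C2: "C2_on (- {0}) (\<phi> c r \<alpha> b)"
    unfolding \<phi>_def by (rule radial_C2.C2_on_radial[OF radial_C2_exp])
  have "\<forall>\<^sub>F z in nhds y. u z \<le> \<phi> c r \<alpha> b z"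
  proof -
    have "open (ball 0 r - cball (0 :: real^'n) \<delta>)" by (intro open_Diff) auto
    then have "\<forall>\<^sub>F z in nhds y. z \<in> ball 0 r - cball 0 \<delta>"
      using y by (intro eventually_nhds_in_open) auto
    then show ?thesis
    proof eventually_elim
      case (elim z)
      then have "z \<in> K" by (auto simp: K)
      from above[OF this] show ?case by simp
    qed
  qed
  moreover have "y \<in> ball 0 1 - {0}" using y r \<delta> by auto
  moreover have "\<exists>N. y \<in> N \<and> C2_on N (\<phi> c r \<alpha> b)"
    using C2 y \<delta> by (intro exI[of _ "- {0}"]) auto
  moreover have "\<phi> c r \<alpha> b y = u y" using eq by simp
  ultimately have "eigenvalue_vectors (schouten (\<phi> c r \<alpha> b) y) \<subseteq> UNIV - U_set"
    using visc[unfolded visc_outside_U_def, rule_format, of y "\<phi> c r \<alpha> b"] by simp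
  moreover have "\<not> eigenvalue_vectors (schouten (\<phi> c r \<alpha> b) y) \<subseteq> UNIV - U_set"
    unfolding \<phi>_def m_def
    by (rule barrier_meets_U_set[OF n \<alpha> b(1) _ _ _ c]) (use a b y \<delta> in auto)
  ultimately show False by blast
qed

theorem lemma1p7:
  fixes C0 \<alpha> :: real
  assumes "even CARD('n::finite)" and "4 \<le> CARD('n)"
    and "0 < C0" and "0 < \<alpha>" and "\<alpha> \<le> 1"
  shows "\<exists>C1::real. \<forall>u :: real^'n \<Rightarrow> real.
    (\<forall>x \<in> cball 0 1 - {0}. 0 < u x) \<longrightarrow>
    continuous_on (cball 0 1 - {0}) u \<longrightarrow>
    visc_outside_U (ball 0 1 - {0}) u \<longrightarrow>
    Limsup (at 0) (\<lambda>x. ereal (u x)) < \<infinity> \<longrightarrow>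
    (\<forall>x \<in> cball 0 1 - {0}.
       u x \<le> C0 * norm x powr (- ((real CARD('n) - 2) / 2 * (1 - \<alpha>)))) \<longrightarrow>
    (\<forall>x \<in> cball 0 1 - {0}. u x \<le> C1)"
proof -
  define m where "m = (real CARD('n) - 2) / 2"
  define L where "L = ln C0 / m"
  \<comment> \<open>With \<open>r = exp (- T)\<close>, the quantity \<open>exp (2 * c) / r\<^sup>2\<close> is \<open>exp (2 * \<alpha> * T - 2 * L - 2)\<close>, and
    \<open>T\<close> is chosen to bring it above \<open>4 / \<alpha>\<^sup>2\<close>. The summand \<open>- 1\<close> in \<open>c\<close> absorbs the term
    \<open>z powr \<alpha> / 2\<close> of the barrier.\<close>
  define T where "T = (\<bar>L\<bar> + \<bar>ln (4 / \<alpha>\<^sup>2)\<bar> + 2) / \<alpha>"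
  define r where "r = exp (- T)"
  define c where "c = (1 - \<alpha>) * ln r - L - 1"
  define C1 where "C1 = max (exp (- m * c)) (C0 * r powr (- (m * (1 - \<alpha>))))"
  have m: "0 < m" using assms(2) by (simp add: m_def)
  have T: "\<alpha> * T = \<bar>L\<bar> + \<bar>ln (4 / \<alpha>\<^sup>2)\<bar> + 2" "0 < T"
    using assms(4) by (auto simp: T_def intro!: divide_pos_pos)
  have r: "0 < r" "r < 1" "ln r = - T" using T(2) by (auto simp: r_def)
  have c: "4 / \<alpha>\<^sup>2 < exp (2 * c) / r\<^sup>2"
  proof -
    have "4 / \<alpha>\<^sup>2 = exp (ln (4 / \<alpha>\<^sup>2))" using assms(4) by simp
    also have "\<dots> < exp (2 * (\<alpha> * T) - 2 * L - 2)" unfolding T(1) by simp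
    also have "2 * (\<alpha> * T) - 2 * L - 2 = 2 * c + 2 * T"
      unfolding c_def r(3) by (simp add: algebra_simps)
    also have "exp (2 * c + 2 * T) = exp (2 * c) / r\<^sup>2"
      by (simp add: r_def exp_add exp_minus field_simps flip: exp_double)
    finally show ?thesis .
  qed
  have "u x \<le> C1"
    if cont: "continuous_on (cball 0 1 - {0}) u"
      and visc: "visc_outside_U (ball 0 1 - {0}) u"
      and limsup: "Limsup (at 0) (\<lambda>x. ereal (u x)) < \<infinity>"
      and bound: "\<And>x. x \<in> cball 0 1 - {0} \<Longrightarrow> u x \<le> C0 * norm x powr (- (m * (1 - \<alpha>)))"
      and x: "x \<in> cball 0 1 - {0}"
    for u :: "real^'n \<Rightarrow> real" and x
  proof (cases "norm x \<le> r")
    case False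
    have "u x \<le> C0 * norm x powr (- (m * (1 - \<alpha>)))" by (rule bound[OF x])
    also have "\<dots> \<le> C0 * r powr (- (m * (1 - \<alpha>)))"
      using False assms m r by (intro mult_left_mono powr_mono2') auto
    finally show ?thesis by (simp add: C1_def)
  next
    case True
    have start: "u y < exp (- m * barrier_profile c r \<alpha> (\<alpha> / 2) (y \<bullet> y))"
      if y: "0 < norm y" "norm y \<le> r" for y
    proof -
      define t where "t = norm y / r"
      have t: "0 < t" "t \<le> 1" "ln t \<le> 0" using y r by (auto simp: t_def)
      have lnt: "ln t = ln (norm y) - ln r" using y r by (simp add: t_def ln_div)
      have "barrier_profile c r \<alpha> (\<alpha> / 2) (y \<bullet> y) = c + (1 - \<alpha> / 2) * ln t + t powr \<alpha> / 2"
        using barrier_profile_norm[of y r] y r by (simp add: t_def)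
      also have "\<dots> \<le> c + (1 - \<alpha>) * ln t + 1 / 2"
        using t assms mult_right_mono_neg[of "1 - \<alpha>" "1 - \<alpha> / 2" "ln t"] powr_le1[of \<alpha> t] by simp
      also have "\<dots> < (1 - \<alpha>) * ln (norm y) - L"
        unfolding c_def lnt by (simp add: algebra_simps)
      finally have lt: "exp (- m * ((1 - \<alpha>) * ln (norm y) - L)) <
          exp (- m * barrier_profile c r \<alpha> (\<alpha> / 2) (y \<bullet> y))"
        using m by simp
      have "C0 * norm y powr (- (m * (1 - \<alpha>))) = exp (ln C0 - m * (1 - \<alpha>) * ln (norm y))"
        using y assms(3)
        by (simp add: powr_def diff_conv_add_uminus exp_add del: add_uminus_conv_diff)
      also have "\<dots> = exp (- m * ((1 - \<alpha>) * ln (norm y) - L))"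
        using m by (simp add: L_def field_simps)
      finally have "C0 * norm y powr (- (m * (1 - \<alpha>))) <
          exp (- m * barrier_profile c r \<alpha> (\<alpha> / 2) (y \<bullet> y))"
        using lt by (rule ord_eq_less_trans)
      moreover have "u y \<le> C0 * norm y powr (- (m * (1 - \<alpha>)))"
        using y r by (intro bound) auto
      ultimately show ?thesis by (rule le_less_trans[rotated])
    qed
    have xp: "0 < norm x" using x by auto
    define g where "g = (\<lambda>a. exp (- m * (c + (1 - a) * ln (norm x / r))))"
    have "u x \<le> g a" if "\<alpha> / 2 < a" "a < 1" for a
    proof -
      have "u x < exp (- m * barrier_profile c r \<alpha> a (x \<bullet> x))"
        unfolding m_def
        by (rule subsolution_below_barrier[OF assms(1,2,4,5) r(1,2) c cont visc limsup _ _ _ xp True])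
          (use start that in \<open>auto simp: m_def\<close>)
      also have "\<dots> \<le> g a"
        unfolding g_def using barrier_profile_norm[of x r] xp r m by simp
      finally show ?thesis by simp
    qed
    then have "\<forall>\<^sub>F a in at_left 1. u x \<le> g a"
      using eventually_at_left_real[of "\<alpha> / 2" 1] assms(5) by (auto elim: eventually_mono)
    moreover have "(g \<longlongrightarrow> g 1) (at_left 1)"
      unfolding g_def by (intro tendsto_intros)
    ultimately have "u x \<le> g 1"
      by (intro tendsto_lowerbound) auto
    then show ?thesis by (simp add: g_def C1_def)
  qed
  then show ?thesis
    unfolding m_def by (intro exI[of _ C1] allI impI ballI) auto
qed

end
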